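(* For every fixed integer $k\ge 3$ there exists a constant $\delta=\delta(k)>0$, depending only on $k$, such that $\xi_k\ge 1+\delta$.
   Context: A distance graph in $\mathbb{R}^n$ is a graph $G=(V,E)$ with $V\subseteq\mathbb{R}^n$ such that, for some fixed $a>0$, $E\subseteq\{\{\mathbf{x},\mathbf{y}\}:\mathbf{x},\mathbf{y}\in V,\ |\mathbf{x}-\mathbf{y}|=a\}$ (not all such pairs need be edges); by homothety one may take $a=1$. For $n,k\in\mathbb{N}$, let $\mathcal{G}(n,k)$ be the family of all distance graphs in $\mathbb{R}^n$ that contain no cycle of length at most $k$. Define $\xi_k=\liminf_{n\to\infty}\max_{G\in\mathcal{G}(n,k)}(\chi(G))^{1/n}$, where $\chi$ denotes the chromatic number (the maximum being understood as a supremum). Equivalently, $\xi_k\ge 1+\delta$ means there is a sequence of distance graphs $G_n$ in $\mathbb{R}^n$ with girth greater than $k$ and $\chi(G_n)\ge(1+\delta+o(1))^n$. *)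

theory Defs
  imports "HOL-Analysis.Analysis"
begin

type_synonym 'a graph = "'a set \<times> 'a set set"

abbreviation verts :: "'a graph \<Rightarrow> 'a set" where "verts G \<equiv> fst G"
abbreviation edges :: "'a graph \<Rightarrow> 'a set set" where "edges G \<equiv> snd G"

definition is_cycle :: "'a graph \<Rightarrow> 'a list \<Rightarrow> bool" where
  "is_cycle G p \<longleftrightarrow> length p \<ge> 3 \<and> distinct p \<and> set p \<subseteq> verts G \<and>
     (\<forall>i < length p. {p ! i, p ! (Suc i mod length p)} \<in> edges G)"

definition colourable :: "'a graph \<Rightarrow> nat \<Rightarrow> bool" where
  "colourable G c \<longleftrightarrow> (\<exists>f :: 'a \<Rightarrow> nat. (\<forall>v \<in> verts G. f v < c) \<and>
     (\<forall>u v. {u, v} \<in> edges G \<longrightarrow> f u \<noteq> f v))"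

text \<open>The value is \<open>\<infinity>\<close> (the infimum of the empty set) if no finite number of colours suffices.\<close>
definition chromatic_number :: "'a graph \<Rightarrow> enat" where
  "chromatic_number G = Inf {enat c | c. colourable G c}"

text \<open>Since the dimension varies inside the statement, \<open>\<real>\<close> to the power \<open>n\<close> is represented by the
  real sequences vanishing from index \<open>n\<close> on, i.e. by the points of \<open>Euclidean_space n\<close>.\<close>
definition distance_graph :: "nat \<Rightarrow> (nat \<Rightarrow> real) graph \<Rightarrow> bool" where
  "distance_graph n G \<longleftrightarrow> verts G \<subseteq> topspace (Euclidean_space n) \<and>
     (\<exists>a > 0. edges G \<subseteq> {{x, y} | x y. x \<in> verts G \<and> y \<in> verts G \<and>
                                   L2_set (\<lambda>i. x i - y i) {..<n} = a})"

definition high_girth_distance_graphs :: "nat \<Rightarrow> nat \<Rightarrow> (nat \<Rightarrow> real) graph set" where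
  "high_girth_distance_graphs n k =
     {G. distance_graph n G \<and> \<not> (\<exists>p. is_cycle G p \<and> length p \<le> k)}"

fun enat_root :: "nat \<Rightarrow> enat \<Rightarrow> ereal" where
  "enat_root n (enat c) = ereal (real c powr (1 / real n))"
| "enat_root n \<infinity> = \<infinity>"

text \<open>The supremum is taken in the extended reals, so that no finiteness assumption is needed;
  dimension \<open>n = 0\<close> does not influence the limit inferior.\<close>
definition xi :: "nat \<Rightarrow> ereal" where
  "xi k = liminf (\<lambda>n. SUP G \<in> high_girth_distance_graphs n k. enat_root n (chromatic_number G))"

end

theory Submission
  imports Defs "HOL-Combinatorics.Permutations"
begin

text \<open>Consider the graph on the subsets of a set with \<open>N = 5qr\<close> elements, \<open>q\<close> a power of two, whose
  edges join the subsets at Hamming distance \<open>2qr\<close>. By the Frankl--Wilson argument, a family of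
  \<open>(2q - 1)\<close>-subsets of a set with \<open>5q\<close> elements that is exponentially dense in \<open>q\<close> contains two
  members meeting in \<open>q - 1\<close> points. Blowing every point up to \<open>r\<close> points and averaging over all
  copies of this configuration under the symmetries of the cube, every set of at least
  \<open>2 (2/3)^q 2^N\<close> vertices spans at least the fraction \<open>1 / 1536^q\<close> of all edges.

  For \<open>r\<close> large in terms of \<open>k\<close>, the degree of the graph dominates the \<open>k\<close>-th power of this loss.
  Edges can then be chosen greedily so that the degrees stay bounded by \<open>32 (1536^q)^2\<close>, no cycle of
  length at most \<open>k\<close> is closed, and each edge lies inside a fixed share of the dense vertex sets not
  yet hit: the forbidden edges are those at saturated vertices or between vertices at distance at
  most \<open>k\<close>, and they are few. In the end every dense set contains an edge, so all colour classes are
  sparse and the chromatic number is at least \<open>(3/2)^q / 2\<close>.\<close>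

section \<open>Families avoiding an intersection size\<close>

text \<open>By absorption \<open>2 ^ a\<close> divides
  \<open>Suc t * (t choose (2 ^ a - 1))\<close>. An odd binomial coefficient is coprime to
  \<open>2 ^ a\<close>, so the whole power would have to divide \<open>Suc t\<close>.\<close>

lemma even_binomial_unless_dvd_Suc:
  assumes "\<not> 2 ^ a dvd Suc t" and "0 < a"
  shows "even (t choose (2 ^ a - 1))"
proof (rule ccontr)
  assume "odd (t choose (2 ^ a - 1))"
  then have "coprime (2 ^ a) (t choose (2 ^ a - 1))"
    by simp
  moreover have "2 ^ a * (Suc t choose 2 ^ a) = Suc t * (t choose (2 ^ a - 1))"
    using Suc_times_binomial_eq[of t "2 ^ a - 1"] by (simp add: mult.commute)
  then have "2 ^ a dvd Suc t * (t choose (2 ^ a - 1))"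
    by (metis dvd_triv_left)
  ultimately show False
    using assms(1) coprime_dvd_mult_left_iff by blast
qed

text \<open>The inner entries of row \<open>2 ^ b\<close> of Pascal's triangle are even, so
  neighbouring entries of the row before it have equal parity, and that row starts with 1.\<close>

lemma odd_binomial_two_power_minus_one:
  assumes "j < 2 ^ b"
  shows "odd ((2 ^ b - 1) choose j :: nat)"
  using assms
proof (induction j)
  case (Suc j)
  have "even ((2 ^ b :: nat) choose Suc j)"
  proof (rule ccontr)
    assume "odd ((2 ^ b :: nat) choose Suc j)"
    then have "coprime (2 ^ b) ((2 ^ b :: nat) choose Suc j)"
      by simp
    moreover have "Suc j * ((2 ^ b :: nat) choose Suc j) = 2 ^ b * ((2 ^ b - 1) choose j)"
      using Suc_times_binomial_eq[of "2 ^ b - 1" j] by (simp add: mult.commute)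
    then have "2 ^ b dvd Suc j * ((2 ^ b :: nat) choose Suc j)"
      by (metis dvd_triv_left)
    ultimately have "2 ^ b dvd Suc j"
      using coprime_dvd_mult_left_iff by blast
    then show False
      using Suc.prems by (simp add: nat_dvd_not_less)
  qed
  moreover have "(2 ^ b :: nat) choose Suc j
      = ((2 ^ b - 1) choose j) + ((2 ^ b - 1) choose Suc j)"
    using binomial_Suc_Suc[of "2 ^ b - 1" j] by simp
  ultimately show ?case
    using Suc by simp
qed simp

text \<open>Frankl--Wilson modulo a power of two. Since the number of \<open>(q - 1)\<close>-subsets of \<open>A \<inter> B\<close> is odd
  only for \<open>A = B\<close>, the incidence vectors of members against \<open>(q - 1)\<close>-subsets are orthonormal over
  the field with two elements; independence is expressed as injectivity of the parity map \<open>g\<close>.\<close>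
lemma card_family_avoiding_intersection:
  fixes q :: nat and X :: "'a set"
  assumes q: "q = 2 ^ a" "0 < a" and X: "finite X"
    and F: "\<And>A. A \<in> F \<Longrightarrow> A \<subseteq> X \<and> card A = 2 * q - 1"
    and avoid: "\<And>A B. A \<in> F \<Longrightarrow> B \<in> F \<Longrightarrow> card (A \<inter> B) \<noteq> q - 1"
  shows "card F \<le> card X choose (q - 1)"
proof -
  define T where "T = {Y. Y \<subseteq> X \<and> card Y = q - 1}"
  \<comment> \<open>\<open>g P\<close> encodes, as a subset of \<open>T\<close>, the sum modulo 2 of
    the incidence vectors of the members of \<open>P\<close>.\<close>
  define g where "g P = {Y \<in> T. odd (card {A \<in> P. Y \<subseteq> A})}" for P
  have q2: "2 \<le> q"
    using q self_le_power[of 2 a] by (cases a) auto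
  have finF: "finite F"
    using F X by (metis PowI finite_Pow_iff finite_subset subsetI)
  have finT: "finite T"
    using X by (auto simp: T_def intro: finite_subset[of _ "Pow X"])
  have cnt: "card {Y \<in> T. Y \<subseteq> A \<and> Y \<subseteq> B} = card (A \<inter> B) choose (q - 1)"
    if "A \<in> F" "B \<in> F" for A B
  proof -
    have "{Y \<in> T. Y \<subseteq> A \<and> Y \<subseteq> B} = {Y. Y \<subseteq> A \<inter> B \<and> card Y = q - 1}"
      using F[OF that(1)] by (auto simp: T_def)
    then show ?thesis
      using F[OF that(1)] X by (metis finite_Int finite_subset n_subsets)
  qed
  have par: "odd (card {Y \<in> T. Y \<subseteq> A \<and> Y \<subseteq> B}) \<longleftrightarrow> A = B" if "A \<in> F" "B \<in> F" for A B
  proof (cases "A = B")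
    case True
    \<comment> \<open>On the diagonal the count is \<open>(2 * q - 1) choose (q - 1)\<close>, an
      entry of the all-odd row \<open>2 ^ Suc a - 1\<close>.\<close>
    have "2 * q - 1 = 2 ^ Suc a - 1" "q - 1 < 2 ^ Suc a"
      using q q2 by auto
    then show ?thesis
      using True cnt[OF that] F[OF that(1)] odd_binomial_two_power_minus_one[of "q - 1" "Suc a"]
      by simp
  next
    case False
    have fin: "finite A" "finite B"
      using F[OF that(1)] F[OF that(2)] X finite_subset by auto
    have "A \<inter> B \<subset> A"
      using False F[OF that(1)] F[OF that(2)] fin
      by (metis Int_lower2 card_subset_eq inf.absorb_iff1 inf_le1 psubsetI)
    then have "card (A \<inter> B) < 2 * q - 1"
      using F[OF that(1)] fin psubset_card_mono by metis
    \<comment> \<open>\<open>Suc (card (A \<inter> B))\<close> lies between 1 and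
      \<open>2 * q - 1\<close>, where the only multiple of \<open>q\<close> is \<open>q\<close>
      itself, and that value is the avoided intersection size.\<close>
    then have "\<not> q dvd Suc (card (A \<inter> B))"
    proof (intro notI, elim dvdE)
      fix c
      assume less: "card (A \<inter> B) < 2 * q - 1" and c: "Suc (card (A \<inter> B)) = q * c"
      have "q * c < q * 2"
        using less c by linarith
      then have "c = 0 \<or> c = 1"
        by (simp add: less_2_cases_iff)
      then show False
        using c avoid[OF that] by auto
    qed
    then show ?thesis
      using False cnt[OF that] even_binomial_unless_dvd_Suc[of a] q by auto
  qed
  \<comment> \<open>By orthonormality, pairing \<open>g P\<close> with the incidence vector of
    \<open>B\<close> modulo 2 reveals whether \<open>B\<close> belongs to \<open>P\<close>;
    exchanging two sums computes the pairing.\<close>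
  have rec: "B \<in> P \<longleftrightarrow> odd (card {Y \<in> g P. Y \<subseteq> B})" if P: "P \<subseteq> F" and B: "B \<in> F" for P B
  proof -
    have finP: "finite P"
      using P finF finite_subset by blast
    have "(\<Sum>A\<in>P. card {Y \<in> T. Y \<subseteq> A \<and> Y \<subseteq> B})
        = (\<Sum>A\<in>P. \<Sum>Y | Y \<in> T \<and> Y \<subseteq> B. if Y \<subseteq> A then 1 else 0)"
      using finT by (intro sum.cong refl) (simp add: sum.If_cases Int_def conj_ac)
    also have "\<dots> = (\<Sum>Y | Y \<in> T \<and> Y \<subseteq> B. card {A \<in> P. Y \<subseteq> A})"
      using finP by (subst sum.swap) (simp add: sum.If_cases Int_def)
    finally have eq: "(\<Sum>A\<in>P. card {Y \<in> T. Y \<subseteq> A \<and> Y \<subseteq> B})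
        = (\<Sum>Y | Y \<in> T \<and> Y \<subseteq> B. card {A \<in> P. Y \<subseteq> A})" .
    have "odd (\<Sum>A\<in>P. card {Y \<in> T. Y \<subseteq> A \<and> Y \<subseteq> B})
        \<longleftrightarrow> odd (card {A \<in> P. odd (card {Y \<in> T. Y \<subseteq> A \<and> Y \<subseteq> B})})"
      using finP by (simp add: even_sum_iff)
    also have "{A \<in> P. odd (card {Y \<in> T. Y \<subseteq> A \<and> Y \<subseteq> B})} = (if B \<in> P then {B} else {})"
      using par P B by auto
    finally have "B \<in> P \<longleftrightarrow> odd (\<Sum>Y | Y \<in> T \<and> Y \<subseteq> B. card {A \<in> P. Y \<subseteq> A})"
      using eq by auto
    also have "\<dots> \<longleftrightarrow> odd (card {Y \<in> {Y. Y \<in> T \<and> Y \<subseteq> B}. odd (card {A \<in> P. Y \<subseteq> A})})"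
      using finT by (simp add: even_sum_iff)
    also have "{Y \<in> {Y. Y \<in> T \<and> Y \<subseteq> B}. odd (card {A \<in> P. Y \<subseteq> A})} = {Y \<in> g P. Y \<subseteq> B}"
      by (auto simp: g_def)
    finally show ?thesis .
  qed
  have "inj_on g (Pow F)"
    by (intro inj_onI set_eqI) (metis PowD rec subsetD)
  moreover have "g ` Pow F \<subseteq> Pow T"
    by (auto simp: g_def)
  ultimately have "card (Pow F) \<le> card (Pow T)"
    using finT card_inj_on_le by blast
  then have "card F \<le> card T"
    using finT finF by (simp add: card_Pow)
  also have "card T = card X choose (q - 1)"
    using X by (simp add: T_def n_subsets)
  finally show ?thesis .
qed

text \<open>The lower index climbs from \<open>q - 1\<close> to \<open>2 * q - 1\<close> in
  \<open>q\<close> steps. Each step multiplies the coefficient by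
  \<open>(5 * q - i) / (i + 1)\<close>, which is at least 3/2 while
  \<open>i < 2 * q - 1\<close>.\<close>

lemma binomial_ratio_three_halves:
  assumes "0 < q"
  shows "(3 / 2) ^ q * real (5 * q choose (q - 1)) \<le> real (5 * q choose (2 * q - 1))"
proof -
  have step: "(3 / 2) ^ j * real (5 * q choose (q - 1)) \<le> real (5 * q choose (q - 1 + j))"
    if "j \<le> q" for j
    using that
  proof (induction j)
    case (Suc j)
    let ?i = "q - 1 + j"
    have i: "?i < 2 * q - 1"
      using Suc.prems assms by simp
    have "Suc ?i * (5 * q choose Suc ?i) = (5 * q choose ?i) * (5 * q - ?i)"
      using binomial_absorption[of ?i "5 * q"] binomial_absorb_comp[of "5 * q" ?i]
      by (simp add: mult.commute)
    then have e: "real (Suc ?i) * real (5 * q choose Suc ?i)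
        = real (5 * q choose ?i) * real (5 * q - ?i)"
      by (metis of_nat_mult)
    have "3 / 2 * real (Suc ?i) \<le> real (5 * q - ?i)"
      using i by simp
    then have "3 / 2 * real (Suc ?i) * real (5 * q choose ?i)
        \<le> real (Suc ?i) * real (5 * q choose Suc ?i)"
      unfolding e by (metis mult.commute mult_right_mono of_nat_0_le_iff)
    then have "real (Suc ?i) * (3 / 2 * real (5 * q choose ?i))
        \<le> real (Suc ?i) * real (5 * q choose Suc ?i)"
      by (simp only: mult_ac)
    then have "3 / 2 * real (5 * q choose ?i) \<le> real (5 * q choose Suc ?i)"
      by (rule mult_left_le_imp_le) simp
    then show ?case
      using Suc by simp
  qed simp
  show ?thesis
    using step[of q] assms by (simp add: mult_2)
qed

section \<open>Supersaturation in the Hamming cube\<close>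

text \<open>The permutations split into classes by the image of \<open>T\<close>, and composing with
  a permutation that carries \<open>Z\<close> to \<open>Z'\<close> shows that all classes have the
  same size.\<close>

lemma card_permutes_image_eq:
  assumes X: "finite X" and T: "T \<subseteq> X" and Y: "Y \<subseteq> X" "card Y = card T"
  shows "card {\<pi>. \<pi> permutes X \<and> \<pi> ` T = Y} * (card X choose card T) = fact (card X)"
proof -
  define P where "P Z = {\<pi>. \<pi> permutes X \<and> \<pi> ` T = Z}" for Z
  define K where "K = {Z. Z \<subseteq> X \<and> card Z = card T}"
  have finP: "finite (P Z)" for Z
    using finite_permutations[OF X] by (rule rev_finite_subset) (auto simp: P_def)
  have finK: "finite K"
    using X by (auto simp: K_def intro: finite_subset[of _ "Pow X"])
  have le: "card (P Z) \<le> card (P Z')" if "Z \<in> K" "Z' \<in> K" for Z Z'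
  proof -
    have fin: "finite Z" "finite Z'" and sub: "Z \<subseteq> X" "Z' \<subseteq> X" and c: "card Z = card Z'"
      using that X finite_subset by (auto simp: K_def)
    obtain f where f: "bij_betw f Z Z'"
      using fin c finite_same_card_bij by blast
    have "card (X - Z) = card (X - Z')"
      using fin sub c by (simp add: card_Diff_subset)
    then obtain g where g: "bij_betw g (X - Z) (X - Z')"
      using X finite_same_card_bij by (metis finite_Diff)
    define s where "s x = (if x \<in> Z then f x else if x \<in> X then g x else x)" for x
    have s1: "bij_betw s Z Z'"
      using f by (rule bij_betw_cong[THEN iffD1, rotated]) (simp add: s_def)
    have "bij_betw s (X - Z) (X - Z')"
      using g by (rule bij_betw_cong[THEN iffD1, rotated]) (simp add: s_def)
    then have "bij_betw s (Z \<union> (X - Z)) (Z' \<union> (X - Z'))"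
      using s1 by (intro bij_betw_combine) auto
    then have "bij_betw s X X"
      using sub by (simp add: Un_absorb1)
    then have s: "s permutes X"
      using sub by (intro bij_imp_permutes) (auto simp: s_def)
    have "(\<lambda>\<pi>. s \<circ> \<pi>) ` P Z \<subseteq> P Z'"
      using s s1 by (auto simp: P_def permutes_compose image_comp[symmetric] bij_betw_def)
    moreover have "inj_on (\<lambda>\<pi>. s \<circ> \<pi>) (P Z)"
      using permutes_inj[OF s] by (auto simp: inj_on_def fun.inj_map_strong inj_compose fun_eq_iff)
    ultimately show ?thesis
      using finP card_inj_on_le by blast
  qed
  have YK: "Y \<in> K"
    using Y by (simp add: K_def)
  have "{\<pi>. \<pi> permutes X} = (\<Union>Z\<in>K. P Z)"
  proof (intro set_eqI iffI)
    fix \<pi> assume "\<pi> \<in> {\<pi>. \<pi> permutes X}"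
    then have p: "\<pi> permutes X" by simp
    have "\<pi> ` T \<in> K"
      using p T permutes_image[OF p] card_image[OF permutes_inj_on[OF p]] by (auto simp: K_def)
    then show "\<pi> \<in> (\<Union>Z\<in>K. P Z)"
      using p by (auto simp: P_def)
  qed (auto simp: P_def)
  then have "fact (card X) = card (\<Union>Z\<in>K. P Z)"
    using card_permutations[OF refl X] by simp
  also have "\<dots> = (\<Sum>Z\<in>K. card (P Z))"
    using finK finP by (intro card_UN_disjoint) (auto simp: P_def)
  also have "\<dots> = (\<Sum>Z\<in>K. card (P Y))"
    using le YK by (intro sum.cong refl antisym) auto
  also have "\<dots> = card (P Y) * (card X choose card T)"
    using X by (simp add: K_def n_subsets)
  finally show ?thesis
    by (simp add: P_def)
qed

text \<open>Average the template \<open>L\<close> over the group generated by permutations of \<open>X\<close> and translations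
  \<open>A \<mapsto> sym_diff z A\<close>, which acts transitively on the pairs at distance \<open>d\<close>.\<close>
lemma supersaturation:
  fixes X :: "'a set" and d :: nat
  defines "E \<equiv> {(u, v). u \<subseteq> X \<and> v \<subseteq> X \<and> card (sym_diff u v) = d}"
  assumes X: "finite X" and L: "L \<subseteq> Pow X" and L0: "L \<noteq> {}"
    and edge: "\<And>F. F \<subseteq> L \<Longrightarrow> \<alpha> < card F \<Longrightarrow> \<exists>A\<in>F. \<exists>B\<in>F. card (sym_diff A B) = d"
    and S: "S \<subseteq> Pow X" and large: "2 * \<alpha> * 2 ^ card X \<le> card S * card L"
  shows "(card X choose d) * card S \<le> 2 * card L ^ 2 * card (E \<inter> S \<times> S)"
proof -
  define G where "G = {\<pi>. \<pi> permutes X} \<times> Pow X"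
  define h where "h A g = (case g of (\<pi>, z) \<Rightarrow> sym_diff z (\<pi> ` A))" for A and g :: "('a \<Rightarrow> 'a) \<times> 'a set"
  define good where "good = {g \<in> G. \<alpha> < card {A \<in> L. h A g \<in> S}}"
  define n where "n = card X"
  have finG: "finite G" and finL: "finite L" and finS: "finite S"
    using X L S finite_permutations[OF X] by (auto simp: G_def intro: finite_subset)
  have cG: "card G = fact n * 2 ^ n"
    using X card_permutations[OF refl X] by (simp add: G_def card_cartesian_product card_Pow n_def)
  \<comment> \<open>A random symmetry carries a fixed \<open>A\<close> to a uniformly distributed
    vertex: the involution \<open>t\<close> exchanges the translation \<open>z\<close> for the image
    of \<open>A\<close>.\<close>
  have hit: "card {g \<in> G. h A g \<in> S} = fact n * card S" if "A \<in> L" for A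
  proof -
    have sub: "\<pi> ` A \<subseteq> X" if "\<pi> permutes X" for \<pi>
      using that L \<open>A \<in> L\<close> permutes_image[OF that] by blast
    define t where "t = (\<lambda>(\<pi>, z). (\<pi> :: 'a \<Rightarrow> 'a, sym_diff z (\<pi> ` A)))"
    have dd: "sym_diff (sym_diff z U) U = z" for z U :: "'a set"
      by blast
    have inv: "t (t g) = g" for g
      by (cases g) (simp only: t_def prod.case dd)
    have "bij_betw t {g \<in> G. h A g \<in> S} ({\<pi>. \<pi> permutes X} \<times> S)"
    proof (rule bij_betw_byWitness[where f' = t])
      show "t ` {g \<in> G. h A g \<in> S} \<subseteq> {\<pi>. \<pi> permutes X} \<times> S"
        by (auto simp: G_def h_def t_def)
      show "t ` ({\<pi>. \<pi> permutes X} \<times> S) \<subseteq> {g \<in> G. h A g \<in> S}"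
      proof
        fix g assume "g \<in> t ` ({\<pi>. \<pi> permutes X} \<times> S)"
        then obtain \<pi> z where *: "\<pi> permutes X" "z \<in> S" and g: "g = (\<pi>, sym_diff z (\<pi> ` A))"
          by (auto simp: t_def)
        then have "g \<in> G"
          using sub[OF *(1)] S by (auto simp: G_def)
        moreover have "h A g \<in> S"
          using * by (simp only: h_def g prod.case dd)
        ultimately show "g \<in> {g \<in> G. h A g \<in> S}"
          by simp
      qed
    qed (use inv in blast)+
    then have "card {g \<in> G. h A g \<in> S} = card ({\<pi>. \<pi> permutes X} \<times> S)"
      by (rule bij_betw_same_card)
    then show ?thesis
      using card_permutations[OF refl X] by (simp add: card_cartesian_product n_def)
  qed
  have "card L * (fact n * card S) = (\<Sum>A\<in>L. card {g \<in> G. h A g \<in> S})"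
    using hit by simp
  also have "\<dots> = (\<Sum>g\<in>G. card {A \<in> L. h A g \<in> S})"
    using sum.swap[of "\<lambda>A g. if h A g \<in> S then 1 else 0 :: nat" G L] finG finL
    by (simp add: sum.If_cases Int_def)
  \<comment> \<open>A symmetry outside \<open>good\<close> places at most \<alpha> template members
    in \<open>S\<close>, any other at most \<open>card L\<close>; by \<open>large\<close> the
    \<alpha> part is at most half of the total.\<close>
  also have "\<dots> \<le> (\<Sum>g\<in>G. \<alpha> + (if g \<in> good then card L else 0))"
    using finL by (intro sum_mono) (auto simp: good_def intro!: trans_le_add2 card_mono)
  also have "\<dots> = \<alpha> * (fact n * 2 ^ n) + card L * card good"
    using finG cG by (simp add: sum.distrib sum.If_cases good_def Int_def mult.commute)
  finally have "2 * card L * (fact n * card S) \<le> 2 * \<alpha> * 2 ^ n * fact n + 2 * card L * card good"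
    by (simp add: algebra_simps)
  also have "2 * \<alpha> * 2 ^ n * fact n \<le> card S * card L * fact n"
    using large by (simp add: n_def)
  finally have "card L * (fact n * card S) \<le> card L * (2 * card good)"
    by (simp add: algebra_simps)
  then have lower: "fact n * card S \<le> 2 * card good"
    using L0 finL by (simp add: card_gt_0_iff)
  define R where "R A B = {g \<in> G. (h A g, h B g) \<in> E \<inter> S \<times> S}" for A B
  have finE: "finite (E \<inter> S \<times> S)"
    using finS by simp
  have R: "card (R A B) * (n choose d) \<le> card (E \<inter> S \<times> S) * fact n" if AB: "A \<in> L" "B \<in> L" for A B
  proof -
    define Q where "Q u v = {g \<in> G. h A g = u \<and> h B g = v}" for u v
    have finQ: "finite (Q u v)" for u v
      using finG by (simp add: Q_def)
    have sd: "sym_diff (h A (\<pi>, z)) (h B (\<pi>, z)) = \<pi> ` sym_diff A B" if "\<pi> permutes X" for \<pi> z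
      using permutes_inj[OF that] by (auto simp: h_def image_Un image_set_diff)
    \<comment> \<open>The permutation must carry \<open>sym_diff A B\<close> onto
      \<open>sym_diff u v\<close>, and \<open>z\<close> is then forced by the image of
      \<open>A\<close>. A pair at a distance other than \<open>d\<close> never reaches an
      edge.\<close>
    have Qle: "card (Q u v) * (n choose d) \<le> fact n" if uv: "(u, v) \<in> E" for u v
    proof (cases "card (sym_diff A B) = d")
      case True
      have "inj_on fst (Q u v)"
        by (intro inj_onI) (auto simp: Q_def h_def)
      moreover have "fst ` Q u v \<subseteq> {\<pi>. \<pi> permutes X \<and> \<pi> ` sym_diff A B = sym_diff u v}"
      proof
        fix \<pi> assume "\<pi> \<in> fst ` Q u v"
        then obtain z where "\<pi> permutes X" "h A (\<pi>, z) = u" "h B (\<pi>, z) = v"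
          by (auto simp: Q_def G_def)
        then show "\<pi> \<in> {\<pi>. \<pi> permutes X \<and> \<pi> ` sym_diff A B = sym_diff u v}"
          using sd[of \<pi> z] by simp
      qed
      ultimately have Qc: "card (Q u v) \<le> card {\<pi>. \<pi> permutes X \<and> \<pi> ` sym_diff A B = sym_diff u v}"
        using finite_permutations[OF X] by (intro card_inj_on_le) auto
      have sub: "sym_diff A B \<subseteq> X" "sym_diff u v \<subseteq> X" "card (sym_diff u v) = card (sym_diff A B)"
        using AB L uv True by (auto simp: E_def)
      show ?thesis
        using mult_le_mono1[OF Qc, of "n choose d"] card_permutes_image_eq[OF X sub]
        by (simp only: True n_def)
    next
      case False
      have "Q u v = {}"
      proof (rule ccontr)
        assume "Q u v \<noteq> {}"
        then obtain \<pi> z where "\<pi> permutes X" "h A (\<pi>, z) = u" "h B (\<pi>, z) = v"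
          by (auto simp: Q_def G_def)
        then have "sym_diff u v = \<pi> ` sym_diff A B"
          using sd by metis
        then show False
          using False uv card_image[OF permutes_inj_on[OF \<open>\<pi> permutes X\<close>]] by (auto simp: E_def)
      qed
      then show ?thesis
        by simp
    qed
    have "R A B \<subseteq> (\<Union>(u, v)\<in>E \<inter> S \<times> S. Q u v)"
      by (auto simp: R_def Q_def)
    then have "card (R A B) \<le> card (\<Union>(u, v)\<in>E \<inter> S \<times> S. Q u v)"
      using finE finQ by (intro card_mono) auto
    also have "\<dots> \<le> (\<Sum>(u, v)\<in>E \<inter> S \<times> S. card (Q u v))"
      using card_UN_le[OF finE, of "\<lambda>(u, v). Q u v"] by (simp add: case_prod_unfold)
    finally have "card (R A B) * (n choose d) \<le> (\<Sum>(u, v)\<in>E \<inter> S \<times> S. card (Q u v)) * (n choose d)"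
      by simp
    also have "\<dots> = (\<Sum>(u, v)\<in>E \<inter> S \<times> S. card (Q u v) * (n choose d))"
      by (simp add: sum_distrib_right case_prod_unfold)
    also have "\<dots> \<le> (\<Sum>(u, v)\<in>E \<inter> S \<times> S. fact n)"
      using Qle by (intro sum_mono) auto
    finally show ?thesis
      by (simp add: case_prod_unfold)
  qed
  \<comment> \<open>A good copy has more than \<alpha> members in \<open>S\<close>, so
    \<open>edge\<close> supplies two of them at distance \<open>d\<close>, and symmetries preserve
    distances.\<close>
  have "good \<subseteq> (\<Union>(A, B)\<in>L \<times> L. R A B)"
  proof
    fix g assume "g \<in> good"
    then obtain \<pi> z where g: "g = (\<pi>, z)" "\<pi> permutes X" "z \<subseteq> X" and gG: "g \<in> G"
      and c: "\<alpha> < card {A \<in> L. h A g \<in> S}"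
      by (auto simp: good_def G_def)
    obtain A B where AB: "A \<in> L" "B \<in> L" "h A g \<in> S" "h B g \<in> S" "card (sym_diff A B) = d"
      using edge[OF _ c] by auto
    have "sym_diff (h A g) (h B g) = \<pi> ` sym_diff A B"
      using permutes_inj[OF g(2)] g(1) by (auto simp: h_def image_Un image_set_diff)
    then have "(h A g, h B g) \<in> E"
      using AB S card_image[OF permutes_inj_on[OF g(2)], of "sym_diff A B"] by (auto simp: E_def)
    then show "g \<in> (\<Union>(A, B)\<in>L \<times> L. R A B)"
      using AB gG by (auto simp: R_def)
  qed
  then have "card good \<le> card (\<Union>(A, B)\<in>L \<times> L. R A B)"
    using finL finG by (intro card_mono) (auto simp: R_def)
  also have "\<dots> \<le> (\<Sum>(A, B)\<in>L \<times> L. card (R A B))"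
    using card_UN_le[of "L \<times> L" "\<lambda>(A, B). R A B"] finL by (simp add: case_prod_unfold)
  finally have "card good * (n choose d) \<le> (\<Sum>(A, B)\<in>L \<times> L. card (R A B)) * (n choose d)"
    by simp
  also have "\<dots> = (\<Sum>(A, B)\<in>L \<times> L. card (R A B) * (n choose d))"
    by (simp add: sum_distrib_right case_prod_unfold)
  also have "\<dots> \<le> (\<Sum>(A, B)\<in>L \<times> L. card (E \<inter> S \<times> S) * fact n)"
    using R by (intro sum_mono) auto
  also have "\<dots> = card L ^ 2 * (card (E \<inter> S \<times> S) * fact n)"
    by (simp add: case_prod_unfold card_cartesian_product power2_eq_square)
  finally have "2 * card good * (n choose d) \<le> 2 * card L ^ 2 * (card (E \<inter> S \<times> S) * fact n)"
    by simp
  then have "fact n * card S * (n choose d) \<le> 2 * card L ^ 2 * (card (E \<inter> S \<times> S) * fact n)"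
    by (rule order_trans[OF mult_le_mono1[OF lower]])
  then have "fact n * ((n choose d) * card S) \<le> fact n * (2 * card L ^ 2 * card (E \<inter> S \<times> S))"
    by (simp only: mult_ac)
  then show ?thesis
    by (simp add: n_def)
qed

text \<open>The template consists of the \<open>(2 * q - 1)\<close>-subsets of \<open>5 * q\<close>
  points, each point blown up to a block of \<open>r\<close> coordinates. Two members meeting in
  \<open>q - 1\<close> points then become vertices at distance \<open>2 * q * r\<close>.\<close>

lemma hamming_supersaturation:
  fixes q r :: nat
  defines "X \<equiv> {..<5 * q * r}" and "E \<equiv> {(u, v). u \<subseteq> {..<5 * q * r} \<and> v \<subseteq> {..<5 * q * r} \<and>
      card (sym_diff u v) = 2 * q * r}"
  assumes q: "q = 2 ^ a" "0 < a" and r: "0 < r"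
    and S: "S \<subseteq> Pow X" and large: "2 * 2 ^ (5 * q * r) * 2 ^ q \<le> card S * 3 ^ q"
  shows "((5 * q * r) choose (2 * q * r)) * 2 ^ (5 * q * r) \<le> 1536 ^ q * card (E \<inter> S \<times> S)"
proof -
  define blk where "blk A = {i \<in> X. i div r \<in> A}" for A
  define layer where "layer = {A. A \<subseteq> {..<5 * q} \<and> card A = 2 * q - 1}"
  define L where "L = blk ` layer"
  define \<alpha> where "\<alpha> = 5 * q choose (q - 1)"
  let ?N = "5 * q * r" and ?C = "(5 * q * r) choose (2 * q * r)"
  have q0: "0 < q"
    using q by simp
  have card_blk: "card (blk A) = r * card A" if "A \<subseteq> {..<5 * q}" for A
  proof -
    have "bij_betw (\<lambda>(i, j). i * r + j) (A \<times> {..<r}) (blk A)"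
    proof (rule bij_betw_byWitness[where f' = "\<lambda>i. (i div r, i mod r)"])
      show "(\<lambda>(i, j). i * r + j) ` (A \<times> {..<r}) \<subseteq> blk A"
      proof
        fix x assume "x \<in> (\<lambda>(i, j). i * r + j) ` (A \<times> {..<r})"
        then obtain i j where x: "x = i * r + j" "i \<in> A" "j < r"
          by auto
        then have "Suc i * r \<le> 5 * q * r"
          using that by (intro mult_le_mono1) auto
        then show "x \<in> blk A"
          using x r by (simp add: blk_def X_def)
      qed
      show "(\<lambda>i. (i div r, i mod r)) ` blk A \<subseteq> A \<times> {..<r}"
        using r by (auto simp: blk_def)
    qed (use r in \<open>auto simp: blk_def\<close>)
    then have "card (A \<times> {..<r}) = card (blk A)"
      by (rule bij_betw_same_card)
    then show ?thesis
      by (simp add: card_cartesian_product mult.commute)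
  qed
  have blk_diff: "sym_diff (blk A) (blk B) = blk (sym_diff A B)" for A B
    by (auto simp: blk_def)
  have inj: "inj_on blk layer"
  proof (rule inj_onI)
    fix A B assume AB: "A \<in> layer" "B \<in> layer" "blk A = blk B"
    then have "blk (sym_diff A B) = {}"
      by (simp flip: blk_diff)
    then have "card (sym_diff A B) = 0"
      using card_blk[of "sym_diff A B"] AB r by (auto simp: layer_def)
    moreover have "finite (sym_diff A B)"
      using AB finite_subset[of _ "{..<5 * q}"] by (auto simp: layer_def)
    ultimately show "A = B"
      by auto
  qed
  have cL: "card L = 5 * q choose (2 * q - 1)"
    using card_image[OF inj] by (simp add: L_def layer_def n_subsets)
  have edge: "\<exists>A\<in>F. \<exists>B\<in>F. card (sym_diff A B) = 2 * q * r" if F: "F \<subseteq> L" "\<alpha> < card F" for F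
  proof -
    \<comment> \<open>The intersection theorem speaks of unblown sets, so the family is pulled back
      to the layer.\<close>
    define F0 where "F0 = {A \<in> layer. blk A \<in> F}"
    have "F = blk ` F0"
      using F(1) by (auto simp: F0_def L_def)
    moreover have "inj_on blk F0"
      using inj by (auto simp: F0_def inj_on_def)
    ultimately have "card F0 = card F"
      by (simp add: card_image)
    then have "\<not> card F0 \<le> card {..<5 * q} choose (q - 1)"
      using F(2) by (simp add: \<alpha>_def)
    then obtain A B where AB: "A \<in> F0" "B \<in> F0" "card (A \<inter> B) = q - 1"
      using card_family_avoiding_intersection[OF q, of "{..<5 * q}" F0]
      by (auto simp: F0_def layer_def)
    then have sub: "A \<subseteq> {..<5 * q}" "B \<subseteq> {..<5 * q}" "card A = 2 * q - 1" "card B = 2 * q - 1"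
      by (auto simp: F0_def layer_def)
    then have fin: "finite A" "finite B"
      using finite_subset by auto
    have "card (sym_diff A B) = card (A - B) + card (B - A)"
      using fin by (intro card_Un_disjoint) auto
    \<comment> \<open>Each difference has \<open>(2 * q - 1) - (q - 1) = q\<close> elements.\<close>
    also have "\<dots> = 2 * q"
      using fin AB(3) sub q0 by (simp add: card_Diff_subset_Int Int_commute)
    finally have "card (sym_diff (blk A) (blk B)) = 2 * q * r"
      using card_blk[of "sym_diff A B"] sub unfolding blk_diff by (simp add: Un_least Diff_subset_conv le_supI2)
    then show ?thesis
      using AB by (auto simp: F0_def)
  qed
  have "3 ^ q * \<alpha> \<le> 2 ^ q * card L"
  proof -
    have "(3 / 2) ^ q * real \<alpha> \<le> real (card L)"
      using binomial_ratio_three_halves[OF q0] by (simp add: cL \<alpha>_def)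
    then have "3 ^ q * real \<alpha> \<le> 2 ^ q * real (card L)"
      by (simp add: power_divide field_simps)
    then have "real (3 ^ q * \<alpha>) \<le> real (2 ^ q * card L)"
      by simp
    then show ?thesis
      by (simp only: of_nat_le_iff)
  qed
  then have "3 ^ q * \<alpha> * (2 * 2 ^ ?N) \<le> 2 ^ q * card L * (2 * 2 ^ ?N)"
    by (rule mult_le_mono1)
  also have "\<dots> = 2 * 2 ^ ?N * 2 ^ q * card L"
    by (simp only: mult_ac)
  also have "\<dots> \<le> card S * 3 ^ q * card L"
    using large by (rule mult_le_mono1)
  finally have "3 ^ q * (2 * \<alpha> * 2 ^ card X) \<le> 3 ^ q * (card S * card L)"
    by (simp add: X_def mult_ac)
  then have large': "2 * \<alpha> * 2 ^ card X \<le> card S * card L"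
    by simp
  have "card L \<le> card (Pow {..<5 * q})"
    unfolding L_def card_image[OF inj] by (intro card_mono) (auto simp: layer_def)
  then have "card L \<le> 2 ^ (5 * q)"
    by (simp add: card_Pow)
  then have "card L ^ 2 \<le> (2 ^ (5 * q)) ^ 2"
    by (intro power_mono) auto
  also have "\<dots> = (2 ^ 10) ^ q"
    unfolding power_mult[symmetric] by simp
  also have "\<dots> = 1024 ^ q"
    by simp
  finally have L2: "card L ^ 2 \<le> 1024 ^ q" .
  have "card L > 0"
    using q0 by (simp add: cL)
  then have "L \<noteq> {}"
    by auto
  then have "?C * card S \<le> 2 * card L ^ 2 * card (E \<inter> S \<times> S)"
    using supersaturation[of X L \<alpha> "2 * q * r" S] edge S large'
    by (auto simp: X_def E_def L_def blk_def)
  also have "\<dots> \<le> 2 * 1024 ^ q * card (E \<inter> S \<times> S)"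
    using L2 by (intro mult_le_mono1 mult_le_mono2)
  finally have up: "?C * card S \<le> 2 * 1024 ^ q * card (E \<inter> S \<times> S)" .
  \<comment> \<open>The base 1536 is 1024, from the square of the template size, times 3/2, from the
    density of \<open>S\<close>.\<close>
  have e: "(3 :: nat) ^ q * 1024 ^ q = 2 ^ q * 1536 ^ q"
    by (simp flip: power_mult_distrib)
  have "2 * 2 ^ q * (?C * 2 ^ ?N) = ?C * (2 * 2 ^ ?N * 2 ^ q)"
    by (simp only: mult_ac)
  also have "\<dots> \<le> ?C * (card S * 3 ^ q)"
    using large by (rule mult_le_mono2)
  also have "\<dots> = 3 ^ q * (?C * card S)"
    by (simp only: mult_ac)
  also have "\<dots> \<le> 3 ^ q * (2 * 1024 ^ q * card (E \<inter> S \<times> S))"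
    using up by (rule mult_le_mono2)
  also have "\<dots> = 2 * (3 ^ q * 1024 ^ q) * card (E \<inter> S \<times> S)"
    by (simp only: mult_ac)
  also have "\<dots> = 2 * 2 ^ q * (1536 ^ q * card (E \<inter> S \<times> S))"
    unfolding e by (simp only: mult_ac)
  finally have "2 * 2 ^ q * (?C * 2 ^ ?N) \<le> 2 * 2 ^ q * (1536 ^ q * card (E \<inter> S \<times> S))" .
  then show ?thesis
    by simp
qed

section \<open>Greedy choice of edges without short cycles\<close>

lemma card_relpow_image_le:
  fixes F :: "'a rel"
  assumes "\<And>v. finite (F `` {v})" and "\<And>v. card (F `` {v}) \<le> \<Delta>"
  shows "finite ((F ^^ j) `` {u}) \<and> card ((F ^^ j) `` {u}) \<le> \<Delta> ^ j"
proof (induction j)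
  case (Suc j)
  have eq: "(F ^^ Suc j) `` {u} = (\<Union>v\<in>(F ^^ j) `` {u}. F `` {v})"
    by auto
  have "card ((F ^^ Suc j) `` {u}) \<le> (\<Sum>v\<in>(F ^^ j) `` {u}. card (F `` {v}))"
    unfolding eq using Suc by (intro card_UN_le) simp
  also have "\<dots> \<le> card ((F ^^ j) `` {u}) * \<Delta>"
    using assms sum_bounded_above[of "(F ^^ j) `` {u}" "\<lambda>v. card (F `` {v})" \<Delta>] by simp
  also have "\<dots> \<le> \<Delta> ^ j * \<Delta>"
    using Suc by simp
  finally show ?case
    using Suc assms eq by (simp add: mult.commute)
qed simp

text \<open>Loops turn an exact walk length into an upper bound, since a shorter walk can be padded
  by standing still.\<close>

lemma relpow_Un_Id_mono: "i \<le> j \<Longrightarrow> F ^^ i \<subseteq> (F \<union> Id) ^^ j"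
proof (induction j arbitrary: i)
  case (Suc j)
  show ?case
  proof (cases "i \<le> j")
    case True
    then have "F ^^ i \<subseteq> (F \<union> Id) ^^ j" by (rule Suc.IH)
    then show ?thesis by auto
  next
    case False
    then have "i = Suc j" using Suc.prems by simp
    then show ?thesis
      using Suc.IH[of j] by auto
  qed
qed simp

lemma sym_relpow:
  assumes "sym R"
  shows "sym (R ^^ n)"
proof (induction n)
  case (Suc n)
  then show ?case
    using assms by (auto simp: sym_def) (metis relcomp.relcompI relpow_commute)
qed (simp add: sym_def)

text \<open>Undirected graphs are kept as symmetric relations here, so that being within distance
  \<open>k\<close> becomes membership in \<open>(F \<union> Id) ^^ k\<close>.\<close>

definition has_short_cycle :: "'a rel \<Rightarrow> nat \<Rightarrow> bool" where
  "has_short_cycle F k \<longleftrightarrow> (\<exists>p. 3 \<le> length p \<and> length p \<le> k \<and> distinct p \<and>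
     (\<forall>i < length p. (p ! i, p ! (Suc i mod length p)) \<in> F))"

text \<open>A new short cycle must use the new edge; removing that edge leaves a walk of fewer than
  \<open>k\<close> steps in \<open>F\<close> between its ends, contrary to
  \<open>far\<close>.\<close>

lemma no_short_cycle_insert_edge:
  assumes F: "\<not> has_short_cycle F k" and "sym F" and far: "(u, v) \<notin> (F \<union> Id) ^^ k"
  shows "\<not> has_short_cycle (F \<union> {(u, v), (v, u)}) k"
proof
  assume "has_short_cycle (F \<union> {(u, v), (v, u)}) k"
  then obtain p where p: "3 \<le> length p" "length p \<le> k" "distinct p"
    and e: "\<And>i. i < length p \<Longrightarrow> (p ! i, p ! (Suc i mod length p)) \<in> F \<union> {(u, v), (v, u)}"
    unfolding has_short_cycle_def by blast
  define l where "l = length p"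
  obtain i where i: "i < l" "(p ! i, p ! (Suc i mod l)) \<notin> F"
    using F p unfolding has_short_cycle_def l_def by blast
  then have iuv: "(p ! i, p ! (Suc i mod l)) \<in> {(u, v), (v, u)}"
    using e l_def by blast
  have path: "(p ! (Suc i mod l), p ! ((Suc i + j) mod l)) \<in> F ^^ j" if "j < l" for j
    using that
  proof (induction j)
    case (Suc j)
    let ?a = "(Suc i + j) mod l"
    have a: "?a < l" "Suc ?a mod l = (Suc i + Suc j) mod l"
      using i by (simp_all add: mod_Suc_eq)
    \<comment> \<open>The new edge cannot occur twice: since vertices are distinct, a second
      occurrence would sit at position \<open>i\<close> again or traverse the edge straight back,
      which needs a cycle of length 2.\<close>
    have "(p ! ?a, p ! (Suc ?a mod l)) \<in> F"
    proof (rule ccontr)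
      assume "(p ! ?a, p ! (Suc ?a mod l)) \<notin> F"
      then have "(p ! ?a, p ! (Suc ?a mod l)) \<in> {(u, v), (v, u)}"
        using e a l_def by blast
      then have "p ! ?a = p ! i \<or> p ! ?a = p ! (Suc i mod l) \<and> p ! (Suc ?a mod l) = p ! i"
        using iuv by auto
      moreover have "Suc ?a mod l < l" "Suc i mod l < l"
        using i by simp_all
      ultimately have "?a = i \<or> ?a = Suc i mod l \<and> Suc ?a mod l = i"
        using p(3) a(1) i(1) by (simp add: nth_eq_iff_index_eq l_def)
      moreover have "?a \<noteq> i"
        using Suc.prems i(1) by (cases "Suc i + j < l") (auto simp: mod_if)
      moreover have "?a = Suc i mod l \<Longrightarrow> j = 0"
        using Suc.prems i(1) by (cases "Suc i + j < l") (auto simp: mod_if split: if_splits)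
      ultimately have "(Suc i + Suc 0) mod l = i"
        using a by auto
      then show False
        using p(1) i(1) by (auto simp: mod_if l_def split: if_splits)
    qed
    then show ?case
      using Suc a by (auto intro: relpow_Suc_I)
  qed simp
  have lk: "l - 1 \<le> k"
    using p(2) by (simp add: l_def)
  have "(Suc i + (l - 1)) mod l = i"
    using i by simp
  then have "(p ! (Suc i mod l), p ! i) \<in> F ^^ (l - 1)"
    using path[of "l - 1"] i by simp
  then have *: "(p ! (Suc i mod l), p ! i) \<in> (F \<union> Id) ^^ k"
    using relpow_Un_Id_mono[OF lk, of F] by blast
  have "sym ((F \<union> Id) ^^ k)"
    using \<open>sym F\<close> by (intro sym_relpow sym_Un sym_Id)
  then show False
    using * iuv far by (auto dest: symD)
qed

text \<open>Every set in \<open>U\<close> spans at least \<open>D * card V / h\<close> edges, and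
  the forbidden ones number at most half of that. As there are at most \<open>D * card V\<close>
  edges in all, averaging yields an allowed edge inside a \<open>1 / (2 * h)\<close> share of
  \<open>U\<close>.\<close>

lemma greedy_edge:
  fixes V :: "'a set" and F E :: "'a rel"
  assumes V: "finite V" "V \<noteq> {}" and E: "E \<subseteq> V \<times> V"
    and deg: "\<And>v. v \<in> V \<Longrightarrow> card (E `` {v}) \<le> D" "\<And>v. v \<in> V \<Longrightarrow> card (E\<inverse> `` {v}) \<le> D"
    and U: "finite U" "\<And>S. S \<in> U \<Longrightarrow> D * card V \<le> h * card (E \<inter> S \<times> S)" "U \<noteq> {}"
    and h: "0 < h" and \<Delta>: "0 < \<Delta>" and D: "4 * h * (\<Delta> + 1) ^ k \<le> D"
    and F: "F \<subseteq> E" "\<And>v. card (F `` {v}) \<le> \<Delta>" "8 * h * card F \<le> \<Delta> * card V"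
  shows "\<exists>(u, v)\<in>E. (u, v) \<notin> (F \<union> Id) ^^ k \<and> card (F `` {u}) < \<Delta> \<and> card (F `` {v}) < \<Delta> \<and>
           card U \<le> 2 * h * card {S \<in> U. u \<in> S \<and> v \<in> S}"
proof -
  define W where "W = card V"
  define Sat where "Sat = {v \<in> V. \<Delta> \<le> card (F `` {v})}"
  define bad1 where "bad1 = E \<inter> (Sat \<times> V \<union> V \<times> Sat)"
  define bad2 where "bad2 = {(u, v). u \<in> V \<and> v \<in> V \<and> (u, v) \<in> (F \<union> Id) ^^ k}"
  define good where "good = E - (bad1 \<union> bad2)"
  have finE: "finite E"
    using V E finite_subset by blast
  have finF: "finite F"
    using F(1) finE finite_subset by blast
  have finbad: "finite bad1" "finite bad2"
    using V finE by (auto simp: bad1_def bad2_def intro: finite_subset[of _ "V \<times> V"])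
  have slices: "card R \<le> c * card Z" if "finite Z" "\<And>v. v \<in> Z \<Longrightarrow> finite (R `` {v}) \<and> card (R `` {v}) \<le> c" "R \<subseteq> Z \<times> UNIV"
    for R :: "'a rel" and Z c
  proof -
    have "R = Sigma Z (\<lambda>v. R `` {v})"
      using that(3) by auto
    then have "card R = (\<Sum>v\<in>Z. card (R `` {v}))"
      using that(1,2) by (metis card_SigmaI)
    also have "\<dots> \<le> c * card Z"
      using that(2) sum_bounded_above[of Z "\<lambda>v. card (R `` {v})" c] by (simp add: mult.commute)
    finally show ?thesis .
  qed
  \<comment> \<open>Each saturated vertex uses up \<Delta> pairs of \<open>F\<close>, so the bound
    on \<open>card F\<close> leaves at most \<open>W / (8 * h)\<close> such vertices.\<close>
  have "card Sat * \<Delta> \<le> (\<Sum>v\<in>Sat. card (F `` {v}))"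
    using sum_bounded_below[of Sat \<Delta> "\<lambda>v. card (F `` {v})"] by (simp add: Sat_def)
  also have "\<dots> = card (Sigma Sat (\<lambda>v. F `` {v}))"
    using V finF by (subst card_SigmaI) (auto simp: Sat_def finite_Image)
  also have "\<dots> \<le> card F"
    using finF by (intro card_mono) auto
  finally have "8 * h * (card Sat * \<Delta>) \<le> \<Delta> * W"
    using F(3) unfolding W_def by (meson mult_le_mono2 order_trans)
  then have "\<Delta> * (8 * h * card Sat) \<le> \<Delta> * W"
    by (simp only: mult_ac)
  then have \<Delta>sat: "8 * h * card Sat \<le> W"
    using \<Delta> by simp
  have finSat: "finite Sat" and SatV: "Sat \<subseteq> V"
    using V by (auto simp: Sat_def)
  have "card (E \<inter> Sat \<times> V) \<le> D * card Sat"
  proof (rule slices[OF finSat])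
    fix v assume "v \<in> Sat"
    then have "card (E `` {v}) \<le> D" "finite (E `` {v})" "(E \<inter> Sat \<times> V) `` {v} \<subseteq> E `` {v}"
      using deg SatV finE finite_Image by auto
    then show "finite ((E \<inter> Sat \<times> V) `` {v}) \<and> card ((E \<inter> Sat \<times> V) `` {v}) \<le> D"
      by (meson card_mono finite_subset order_trans)
  qed auto
  moreover have "card ((E \<inter> V \<times> Sat)\<inverse>) \<le> D * card Sat"
  proof (rule slices[OF finSat])
    fix v assume "v \<in> Sat"
    then have "card (E\<inverse> `` {v}) \<le> D" "finite (E\<inverse> `` {v})" "(E \<inter> V \<times> Sat)\<inverse> `` {v} \<subseteq> E\<inverse> `` {v}"
      using deg SatV finE by (auto intro!: finite_Image)
    then show "finite ((E \<inter> V \<times> Sat)\<inverse> `` {v}) \<and> card ((E \<inter> V \<times> Sat)\<inverse> `` {v}) \<le> D"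
      by (meson card_mono finite_subset order_trans)
  qed auto
  moreover have "bad1 = (E \<inter> Sat \<times> V) \<union> (E \<inter> V \<times> Sat)"
    by (auto simp: bad1_def)
  ultimately have "card bad1 \<le> 2 * (D * card Sat)"
    using card_Un_le[of "E \<inter> Sat \<times> V" "E \<inter> V \<times> Sat"] by (simp add: card_inverse)
  then have "4 * h * card bad1 \<le> 4 * h * (2 * (D * card Sat))"
    by (rule mult_le_mono2)
  also have "\<dots> = D * (8 * h * card Sat)"
    by simp
  also have "\<dots> \<le> D * W"
    using \<Delta>sat by (rule mult_le_mono2)
  finally have b1: "4 * h * card bad1 \<le> D * W" .
  have FI: "finite ((F \<union> Id) `` {v})" "card ((F \<union> Id) `` {v}) \<le> \<Delta> + 1" for v
  proof -
    have eq: "(F \<union> Id) `` {v} = insert v (F `` {v})"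
      by auto
    show "finite ((F \<union> Id) `` {v})"
      unfolding eq using finF by (simp add: finite_Image)
    show "card ((F \<union> Id) `` {v}) \<le> \<Delta> + 1"
      unfolding eq using F(2)[of v] finF by (simp add: card_insert_if finite_Image)
  qed
  \<comment> \<open>Near pairs are counted by walks of \<open>k\<close> steps with at most
    \<open>\<Delta> + 1\<close> choices each, the extra choice being the loop.\<close>
  have "card bad2 \<le> (\<Delta> + 1) ^ k * card V"
  proof (rule slices[OF V(1)])
    fix v
    have "bad2 `` {v} \<subseteq> ((F \<union> Id) ^^ k) `` {v}"
      by (auto simp: bad2_def)
    then show "finite (bad2 `` {v}) \<and> card (bad2 `` {v}) \<le> (\<Delta> + 1) ^ k"
      using card_relpow_image_le[OF FI, of k v] by (meson card_mono finite_subset order_trans)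
  qed (auto simp: bad2_def)
  then have "4 * h * card bad2 \<le> 4 * h * ((\<Delta> + 1) ^ k * W)"
    unfolding W_def by (rule mult_le_mono2)
  also have "\<dots> \<le> D * W"
    using mult_le_mono1[OF D, of W] by (simp only: mult.assoc)
  finally have b2: "4 * h * card bad2 \<le> D * W" .
  have bad: "2 * h * card (bad1 \<union> bad2) \<le> D * W"
    using b1 b2 mult_le_mono2[OF card_Un_le[of bad1 bad2], of "4 * h"]
    by (simp add: distrib_left)
  have good: "D * W \<le> 2 * h * card (good \<inter> S \<times> S)" if "S \<in> U" for S
  proof -
    have "card (E \<inter> S \<times> S) \<le> card ((good \<inter> S \<times> S) \<union> (bad1 \<union> bad2))"
      using finE finbad by (intro card_mono) (auto simp: good_def)
    also have "\<dots> \<le> card (good \<inter> S \<times> S) + card (bad1 \<union> bad2)"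
      by (rule card_Un_le)
    finally have "2 * h * card (E \<inter> S \<times> S) \<le> 2 * h * card (good \<inter> S \<times> S) + 2 * h * card (bad1 \<union> bad2)"
      by (metis distrib_left mult_le_mono2)
    then show ?thesis
      using U(2)[OF that] bad by (simp add: W_def)
  qed
  have fing: "finite good"
    using finE by (simp add: good_def)
  have "card good \<le> card E"
    using finE by (intro card_mono) (auto simp: good_def)
  also have "\<dots> \<le> D * W"
    unfolding W_def using V E deg finE by (intro slices) (auto intro: finite_Image)
  finally have gDW: "card good \<le> D * W" .
  have pos: "0 < D * W"
    using V h D by (auto simp: W_def card_gt_0_iff intro: gr0I)
  \<comment> \<open>Double counting of the pairs of a set in \<open>U\<close> and a good edge inside
    it.\<close>
  have "\<exists>e\<in>good. card U \<le> 2 * h * card {S \<in> U. e \<in> S \<times> S}"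
  proof (rule ccontr)
      assume "\<not> ?thesis"
      then have small: "2 * h * card {S \<in> U. e \<in> S \<times> S} < card U" if "e \<in> good" for e
        using that by (simp add: not_le)
      have "card U * (D * W) \<le> (\<Sum>S\<in>U. 2 * h * card (good \<inter> S \<times> S))"
        using good sum_bounded_below[of U "D * W" "\<lambda>S. 2 * h * card (good \<inter> S \<times> S)"] by simp
      also have "\<dots> = 2 * h * (\<Sum>S\<in>U. \<Sum>e\<in>good. if e \<in> S \<times> S then 1 else 0)"
        using fing by (simp add: sum_distrib_left sum.If_cases Int_def)
      also have "\<dots> = (\<Sum>e\<in>good. 2 * h * card {S \<in> U. e \<in> S \<times> S})"
        using U(1) by (subst sum.swap) (simp add: sum_distrib_left sum.If_cases Int_def)
      finally have le: "card U * (D * W) \<le> (\<Sum>e\<in>good. 2 * h * card {S \<in> U. e \<in> S \<times> S})" .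
      then have "good \<noteq> {}"
        using pos U(1,3) by (auto simp: card_gt_0_iff)
      then have "(\<Sum>e\<in>good. 2 * h * card {S \<in> U. e \<in> S \<times> S}) < (\<Sum>e\<in>good. card U)"
        using fing small by (intro sum_strict_mono) auto
      also have "\<dots> \<le> card U * (D * W)"
        using gDW by (simp add: mult.commute)
      finally show False
        using le by simp
  qed
  then obtain u v where uv: "(u, v) \<in> good" "card U \<le> 2 * h * card {S \<in> U. (u, v) \<in> S \<times> S}"
    by auto
  then have "(u, v) \<in> E" "u \<in> V" "v \<in> V"
    using E by (auto simp: good_def)
  with uv show ?thesis
    by (intro bexI[of _ "(u, v)"]) (auto simp: good_def bad1_def bad2_def Sat_def)
qed

text \<open>Each greedy edge hits a \<open>1 / (2 * h)\<close> share of the sets not yet hit. After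
  \<open>2 * h * card V\<close> rounds fewer than one of the at most \<open>2 ^ card V\<close> sets
  remains.\<close>

lemma no_short_cycle_hitting_subset:
  fixes V :: "'a set" and E :: "'a rel"
  assumes V: "finite V" "V \<noteq> {}" and E: "E \<subseteq> V \<times> V" "sym E" "irrefl E"
    and deg: "\<And>v. v \<in> V \<Longrightarrow> card (E `` {v}) \<le> D"
    and \<S>: "\<S> \<subseteq> Pow V" "\<And>S. S \<in> \<S> \<Longrightarrow> D * card V \<le> h * card (E \<inter> S \<times> S)"
    and h: "0 < h" and D: "4 * h * (32 * h ^ 2 + 1) ^ k \<le> D"
  obtains F where "F \<subseteq> E" "sym F" "\<not> has_short_cycle F k" "\<And>S. S \<in> \<S> \<Longrightarrow> F \<inter> S \<times> S \<noteq> {}"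
proof -
  \<comment> \<open>Each round adds two ordered pairs, so \<open>card F \<le> 4 * h * W\<close>
    throughout, and \<open>greedy_edge\<close> asks for
    \<open>8 * h * card F \<le> \<Delta> * W\<close>.\<close>
  define \<Delta> where "\<Delta> = 32 * h ^ 2"
  define W where "W = card V"
  define unhit where "unhit F = {S \<in> \<S>. F \<inter> S \<times> S = {}}" for F
  have fin\<S>: "finite \<S>"
    using \<S>(1) V finite_subset by blast
  have finE: "finite E"
    using V E(1) finite_subset by blast
  have conv: "E\<inverse> = E"
    using E(2) by (simp add: sym_conv_converse_eq)
  have "\<exists>F \<subseteq> E. sym F \<and> \<not> has_short_cycle F k \<and> card F \<le> 2 * i \<and> (\<forall>v. card (F `` {v}) \<le> \<Delta>) \<and>
      real (card (unhit F)) \<le> (1 - 1 / (2 * real h)) ^ i * real (card \<S>)"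
    if "i \<le> 2 * h * W" for i
    using that
  proof (induction i)
    case 0
    have "\<not> has_short_cycle ({} :: 'a rel) k"
      by (auto simp: has_short_cycle_def intro!: exI[of _ 0])
    moreover have "unhit {} = \<S>"
      by (simp add: unhit_def)
    ultimately show ?case
      by (intro exI[of _ "{}"]) (auto simp: sym_def)
  next
    case (Suc i)
    then obtain F where F: "F \<subseteq> E" "sym F" "\<not> has_short_cycle F k" "card F \<le> 2 * i"
      "\<And>v. card (F `` {v}) \<le> \<Delta>"
      "real (card (unhit F)) \<le> (1 - 1 / (2 * real h)) ^ i * real (card \<S>)"
      by auto
    have finF: "finite F"
      using F(1) finE finite_subset by blast
    have h1: "0 \<le> 1 - 1 / (2 * real h)"
      using h by simp
    show ?case
    proof (cases "unhit F = {}")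
      case True
      then show ?thesis
        using F h1 by (intro exI[of _ F]) auto
    next
      case False
      have fU: "finite (unhit F)"
        using fin\<S> by (simp add: unhit_def)
      have "card F \<le> 4 * h * W"
        using F(4) Suc.prems by linarith
      then have "8 * h * card F \<le> 8 * h * (4 * h * W)"
        by (rule mult_le_mono2)
      then have cF: "8 * h * card F \<le> \<Delta> * card V"
        by (simp add: \<Delta>_def W_def power2_eq_square)
      have "\<exists>(u, v)\<in>E. (u, v) \<notin> (F \<union> Id) ^^ k \<and> card (F `` {u}) < \<Delta> \<and> card (F `` {v}) < \<Delta> \<and>
           card (unhit F) \<le> 2 * h * card {S \<in> unhit F. u \<in> S \<and> v \<in> S}"
        using V E deg \<S> h D F cF fU False
        by (intro greedy_edge[where D = D and V = V]) (auto simp: conv \<Delta>_def unhit_def)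
      then obtain u v where uv: "(u, v) \<in> E" "(u, v) \<notin> (F \<union> Id) ^^ k"
        "card (F `` {u}) < \<Delta>" "card (F `` {v}) < \<Delta>"
        "card (unhit F) \<le> 2 * h * card {S \<in> unhit F. u \<in> S \<and> v \<in> S}"
        by auto
      define F' where "F' = F \<union> {(u, v), (v, u)}"
      have "F' \<subseteq> E"
        using F(1) uv(1) E(2) by (auto simp: F'_def dest: symD)
      moreover have "sym F'"
        using F(2) by (auto simp: F'_def sym_def)
      moreover have "\<not> has_short_cycle F' k"
        unfolding F'_def using F(3,2) uv(2) by (rule no_short_cycle_insert_edge)
      moreover have "card F' \<le> 2 * Suc i"
      proof -
        have "card {(u, v), (v, u)} \<le> 2"
          using card_insert_le_m1[of 2 "{(v, u)}" "(u, v)"] by simp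
        then show ?thesis
          using card_Un_le[of F "{(u, v), (v, u)}"] F(4) by (simp add: F'_def)
      qed
      \<comment> \<open>Only \<open>u\<close> and \<open>v\<close> gain a neighbour, and both were
        below the cap; \<open>u \<noteq> v\<close> because \<open>E\<close> is irreflexive.\<close>
      moreover have "card (F' `` {w}) \<le> \<Delta>" for w
      proof -
        have ne: "u \<noteq> v"
          using uv(1) E(3) by (auto simp: irrefl_def)
        have "F' `` {u} = insert v (F `` {u})" "F' `` {v} = insert u (F `` {v})"
          "w \<noteq> u \<Longrightarrow> w \<noteq> v \<Longrightarrow> F' `` {w} = F `` {w}"
          using ne by (auto simp: F'_def)
        then show ?thesis
          using uv(3,4) F(5)[of w] finF
          by (cases "w = u"; cases "w = v") (simp_all add: card_insert_if finite_Image)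
      qed
      moreover have "real (card (unhit F')) \<le> (1 - 1 / (2 * real h)) ^ Suc i * real (card \<S>)"
      proof -
        let ?H = "{S \<in> unhit F. u \<in> S \<and> v \<in> S}"
        have "unhit F' \<subseteq> unhit F - ?H"
          by (auto simp: unhit_def F'_def)
        then have "card (unhit F') \<le> card (unhit F - ?H)"
          using fU by (intro card_mono) auto
        also have "\<dots> = card (unhit F) - card ?H"
          using fU by (intro card_Diff_subset) auto
        finally have "real (card (unhit F')) \<le> real (card (unhit F)) - real (card ?H)"
          using card_mono[OF fU, of ?H] by (simp add: of_nat_diff[symmetric] del: of_nat_diff)
        moreover have "real (card (unhit F)) \<le> 2 * real h * real (card ?H)"
          using uv(5) by (metis of_nat_le_iff of_nat_mult of_nat_numeral)
        then have "real (card (unhit F)) / (2 * real h) \<le> real (card ?H)"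
          using h by (simp add: field_simps)
        ultimately have "real (card (unhit F')) \<le> (1 - 1 / (2 * real h)) * real (card (unhit F))"
          by (simp add: algebra_simps)
        also have "\<dots> \<le> (1 - 1 / (2 * real h)) * ((1 - 1 / (2 * real h)) ^ i * real (card \<S>))"
          using F(6) h1 by (rule mult_left_mono)
        finally show ?thesis
          by (simp add: mult.assoc)
      qed
      ultimately show ?thesis
        by blast
    qed
  qed
  from this[of "2 * h * W"] obtain F where F: "F \<subseteq> E" "sym F" "\<not> has_short_cycle F k"
    and c: "real (card (unhit F)) \<le> (1 - 1 / (2 * real h)) ^ (2 * h * W) * real (card \<S>)"
    by auto
  have "card \<S> \<le> card (Pow V)"
    using \<S>(1) V by (intro card_mono) auto
  then have "card \<S> \<le> 2 ^ W"
    using V by (simp add: card_Pow W_def)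
  then have \<S>W: "real (card \<S>) \<le> 2 ^ W"
    by (rule of_nat_mono[of "card \<S>" "2 ^ W", simplified])
  \<comment> \<open>The surviving share is at most \<open>exp (- W)\<close>, and
    \<open>exp 1 > 2\<close> beats the \<open>2 ^ W\<close> possible sets.\<close>
  have "1 - 1 / (2 * real h) \<le> exp (- (1 / (2 * real h)))"
    using exp_ge_add_one_self[of "- (1 / (2 * real h))"] by simp
  then have "(1 - 1 / (2 * real h)) ^ (2 * h * W) \<le> exp (- (1 / (2 * real h))) ^ (2 * h * W)"
    using h by (intro power_mono) auto
  also have "\<dots> = exp (- real W)"
    using h exp_of_nat_mult[of "2 * h * W" "- (1 / (2 * real h))"] by simp
  also have "\<dots> = exp (- 1) ^ W"
    using exp_of_nat_mult[of W "- 1"] by simp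
  also have "\<dots> < (1 / 2) ^ W"
  proof (rule power_strict_mono)
    have "2 < exp (1 :: real)"
      using ln_2_less_1 by (metis exp_less_cancel_iff exp_ln zero_less_numeral)
    then show "exp (- 1) < (1 / 2 :: real)"
      using less_imp_inverse_less[of 2 "exp 1 :: real"] by (simp add: exp_minus inverse_eq_divide)
  qed (use V in \<open>auto simp: W_def card_gt_0_iff\<close>)
  finally have lt: "(1 - 1 / (2 * real h)) ^ (2 * h * W) < (1 / 2) ^ W" .
  have "(1 - 1 / (2 * real h)) ^ (2 * h * W) * real (card \<S>)
      \<le> (1 - 1 / (2 * real h)) ^ (2 * h * W) * 2 ^ W"
    using \<S>W h by (intro mult_left_mono zero_le_power) auto
  also have "\<dots> < (1 / 2) ^ W * 2 ^ W"
    using lt by (intro mult_strict_right_mono) auto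
  also have "\<dots> = 1"
    using power_mult_distrib[of "1 / 2 :: real" 2 W] by simp
  finally have "card (unhit F) = 0"
    using c by simp
  then have "unhit F = {}"
    using fin\<S> by (simp add: unhit_def)
  then show thesis
    using F by (intro that) (auto simp: unhit_def)
qed

section \<open>Realisation by distance graphs\<close>

text \<open>Sets become indicator vectors, so Hamming distance \<open>d\<close> turns into Euclidean
  distance \<open>sqrt d\<close>; the coordinates from \<open>N\<close> on are 0, which allows any
  dimension \<open>n \<ge> N\<close>.\<close>

lemma distance_graph_of_set_system:
  fixes F :: "nat set rel" and N n d k :: nat
  assumes N: "N \<le> n" and d: "0 < d" and "sym F" and girth: "\<not> has_short_cycle F k"
    and F: "\<And>u v. (u, v) \<in> F \<Longrightarrow> u \<subseteq> {..<N} \<and> v \<subseteq> {..<N} \<and> card (sym_diff u v) = d"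
  obtains G where "G \<in> high_girth_distance_graphs n k"
    and "\<And>c. colourable G c \<Longrightarrow> \<exists>f. (\<forall>u \<subseteq> {..<N}. f u < c) \<and> (\<forall>(u, v) \<in> F. f u \<noteq> f v)"
proof
  define i where "i A = (\<lambda>j. if j \<in> A then 1 else 0 :: real)" for A :: "nat set"
  define G where "G = (i ` Pow {..<N}, (\<lambda>(u, v). {i u, i v}) ` F)"
  have inj: "i A = i B \<longleftrightarrow> A = B" for A B
    by (auto simp: i_def fun_eq_iff split: if_splits)
  have edge: "{i u, i v} \<in> edges G \<longleftrightarrow> (u, v) \<in> F" for u v
    using \<open>sym F\<close> by (auto simp: G_def doubleton_eq_iff inj dest: symD)
  have dist: "L2_set (\<lambda>j. i u j - i v j) {..<n} = sqrt d" if uv: "(u, v) \<in> F" for u v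
  proof -
    have sub: "sym_diff u v \<subseteq> {..<n}"
      using F[OF uv] N by auto
    have "(\<Sum>j<n. (i u j - i v j)\<^sup>2) = (\<Sum>j<n. if j \<in> sym_diff u v then 1 else 0)"
      by (intro sum.cong refl) (auto simp: i_def)
    also have "\<dots> = card ({..<n} \<inter> sym_diff u v)"
      by (auto simp: sum.If_cases intro!: arg_cong[where f = card])
    also have "{..<n} \<inter> sym_diff u v = sym_diff u v"
      using sub by blast
    finally show ?thesis
      using F[OF uv] by (simp add: L2_set_def)
  qed
  have "distance_graph n G"
    unfolding distance_graph_def
  proof (intro conjI exI[of _ "sqrt d"])
    show "verts G \<subseteq> topspace (Euclidean_space n)"
      using N by (auto simp: G_def i_def topspace_Euclidean_space)
    show "edges G \<subseteq> {{x, y} |x y. x \<in> verts G \<and> y \<in> verts G \<and> L2_set (\<lambda>i. x i - y i) {..<n} = sqrt d}"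
    proof
      fix e assume "e \<in> edges G"
      then obtain u v where uv: "(u, v) \<in> F" "e = {i u, i v}"
        by (auto simp: G_def)
      then have "i u \<in> verts G" "i v \<in> verts G"
        using F by (auto simp: G_def)
      then show "e \<in> {{x, y} |x y. x \<in> verts G \<and> y \<in> verts G \<and> L2_set (\<lambda>i. x i - y i) {..<n} = sqrt d}"
        using uv(2) dist[OF uv(1)] by blast
    qed
  qed (use d in simp)
  moreover have "length p > k" if p: "is_cycle G p" for p
  proof (rule ccontr)
    assume "\<not> length p > k"
    define p' where "p' = map (inv_into UNIV i) p"
    have ip: "i (p' ! j) = p ! j" if "j < length p" for j
    proof -
      have "p ! j \<in> range i"
        using p nth_mem[OF that] by (auto simp: is_cycle_def G_def)
      then show ?thesis
        using that by (simp add: p'_def f_inv_into_f)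
    qed
    have "distinct p'"
      unfolding distinct_conv_nth
    proof safe
      fix j l assume "j < length p'" "l < length p'" "j \<noteq> l" "p' ! j = p' ! l"
      then show False
        using p ip[of j] ip[of l] by (auto simp: p'_def is_cycle_def nth_eq_iff_index_eq)
    qed
    moreover have "(p' ! j, p' ! (Suc j mod length p')) \<in> F" if "j < length p'" for j
    proof -
      have j: "j < length p" "Suc j mod length p < length p"
        using that by (auto simp: p'_def intro: mod_less_divisor)
      have "{p ! j, p ! (Suc j mod length p)} \<in> edges G"
        using p j by (simp add: is_cycle_def)
      then have "{i (p' ! j), i (p' ! (Suc j mod length p))} \<in> edges G"
        by (simp only: ip[OF j(1)] ip[OF j(2)])
      then have "(p' ! j, p' ! (Suc j mod length p)) \<in> F"
        by (simp only: edge)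
      then show ?thesis
        by (simp add: p'_def)
    qed
    ultimately have "has_short_cycle F k"
      using p \<open>\<not> length p > k\<close> unfolding has_short_cycle_def is_cycle_def
      by (intro exI[of _ p']) (simp add: p'_def)
    then show False
      using girth by simp
  qed
  ultimately show "G \<in> high_girth_distance_graphs n k"
    by (auto simp: high_girth_distance_graphs_def not_le)
  show "\<exists>f. (\<forall>u \<subseteq> {..<N}. f u < c) \<and> (\<forall>(u, v) \<in> F. f u \<noteq> f v)" if "colourable G c" for c
  proof -
    obtain g where "\<forall>x\<in>verts G. g x < c" "\<forall>x y. {x, y} \<in> edges G \<longrightarrow> g x \<noteq> g y"
      using \<open>colourable G c\<close> by (auto simp: colourable_def)
    then show ?thesis
      using edge by (intro exI[of _ "g \<circ> i"]) (auto simp: G_def)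
  qed
qed

section \<open>Choice of the parameters and the bound on the number of colours\<close>

text \<open>A colour class contains no edge of \<open>F\<close>, hence is not dense and has at most
  \<open>2 * (2 / 3) ^ q * 2 ^ N\<close> vertices, while \<open>c\<close> classes must cover all
  \<open>2 ^ N\<close>.\<close>

lemma exists_high_girth_distance_graph:
  fixes q n k :: nat
  defines "r \<equiv> 14 * k + 7"
  assumes q: "q = 2 ^ a" "0 < a" and n: "5 * q * r \<le> n"
  obtains G where "G \<in> high_girth_distance_graphs n k" and "\<And>c. colourable G c \<Longrightarrow> 3 ^ q \<le> 2 * c * 2 ^ q"
proof -
  define N where "N = 5 * q * r"
  define E where "E = {(u, v). u \<subseteq> {..<N} \<and> v \<subseteq> {..<N} \<and> card (sym_diff u v) = 2 * q * r}"
  define \<S> where "\<S> = {S. S \<subseteq> Pow {..<N} \<and> 2 * 2 ^ N * 2 ^ q \<le> card S * 3 ^ q}"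
  define D where "D = N choose (2 * q * r)"
  define h where "h = (1536 :: nat) ^ q"
  have q0: "0 < q" and r0: "0 < r"
    using q by (simp_all add: r_def)
  have deg: "card (E `` {u}) \<le> D" if "u \<in> Pow {..<N}" for u
  proof -
    have "inj_on (sym_diff u) (E `` {u})"
      by (intro inj_onI) blast
    moreover have "sym_diff u ` (E `` {u}) \<subseteq> {Y. Y \<subseteq> {..<N} \<and> card Y = 2 * q * r}"
      using that by (auto simp: E_def)
    ultimately have "card (E `` {u}) \<le> card {Y. Y \<subseteq> {..<N} \<and> card Y = 2 * q * r}"
      by (rule card_inj_on_le) (auto intro: finite_subset[of _ "Pow {..<N}"])
    then show ?thesis
      by (simp add: n_subsets D_def)
  qed
  have hD: "4 * h * (32 * h ^ 2 + 1) ^ k \<le> D"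
  proof -
    \<comment> \<open>Everything is compared with powers of two, starting from
      \<open>1536 \<le> 2 ^ 11\<close>.\<close>
    have "h \<le> (2 ^ 11) ^ q"
      unfolding h_def by (intro power_mono) auto
    then have h11: "h \<le> 2 ^ (11 * q)"
      by (simp only: power_mult)
    have "4 * h \<le> 2 ^ (2 * q) * 2 ^ (11 * q)"
    proof (rule mult_le_mono[OF _ h11])
      show "4 \<le> (2 :: nat) ^ (2 * q)"
        using q0 self_le_power[of "4 :: nat" q] by (simp add: power_mult)
    qed
    then have h4: "4 * h \<le> 2 ^ (13 * q)"
      by (simp flip: power_add)
    have "32 * h ^ 2 + 1 \<le> 64 * h ^ 2"
      by (simp add: h_def)
    also have "\<dots> \<le> 2 ^ (6 * q) * (2 ^ (11 * q)) ^ 2"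
    proof (intro mult_le_mono power_mono h11)
      show "64 \<le> (2 :: nat) ^ (6 * q)"
        using q0 self_le_power[of "64 :: nat" q] by (simp add: power_mult)
    qed auto
    also have "\<dots> = 2 ^ (28 * q)"
      by (simp flip: power_add power_mult)
    finally have "(32 * h ^ 2 + 1) ^ k \<le> (2 ^ (28 * q)) ^ k"
      by (intro power_mono) auto
    then have "4 * h * (32 * h ^ 2 + 1) ^ k \<le> 2 ^ (13 * q) * (2 ^ (28 * q)) ^ k"
      by (rule mult_le_mono[OF h4])
    also have "\<dots> = 2 ^ (13 * q + 28 * q * k)"
      by (simp flip: power_add power_mult)
    \<comment> \<open>This fixes the choice of \<open>r\<close>:
      \<open>2 * q * r = 28 * q * k + 14 * q\<close> covers the exponent
      \<open>13 * q + 28 * q * k\<close>.\<close>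
    also have "\<dots> \<le> 2 ^ (2 * q * r)"
      by (intro power_increasing) (auto simp: r_def algebra_simps)
    finally have "real (4 * h * (32 * h ^ 2 + 1) ^ k) \<le> real (2 ^ (2 * q * r))"
      by (simp only: of_nat_le_iff)
    \<comment> \<open>The quotient is 5/2, hence at least 2.\<close>
    also have "\<dots> \<le> (real N / real (2 * q * r)) ^ (2 * q * r)"
      using q0 r0 by (simp add: N_def power_mono)
    also have "\<dots> \<le> real D"
      using binomial_ge_n_over_k_pow_k[of "2 * q * r" N, where 'a = real] by (simp add: D_def N_def)
    finally show ?thesis
      by (simp only: of_nat_le_iff)
  qed
  have dense: "D * card (Pow {..<N}) \<le> h * card (E \<inter> S \<times> S)" if "S \<in> \<S>" for S
    using hamming_supersaturation[OF q r0, of S] that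
    by (simp add: \<S>_def E_def D_def h_def N_def card_Pow)
  have E: "E \<subseteq> Pow {..<N} \<times> Pow {..<N}" "sym E" "irrefl E"
    using q0 r0 by (auto simp: E_def sym_def irrefl_def Un_commute)
  have "finite (Pow {..<N})" "Pow {..<N} \<noteq> {}" "\<S> \<subseteq> Pow (Pow {..<N})" "0 < h"
    by (auto simp: \<S>_def h_def)
  from no_short_cycle_hitting_subset[OF this(1,2) E deg this(3) dense this(4) hD]
  obtain F where F: "F \<subseteq> E" "sym F" "\<not> has_short_cycle F k"
    and hit: "\<And>S. S \<in> \<S> \<Longrightarrow> F \<inter> S \<times> S \<noteq> {}"
    by blast
  have F': "u \<subseteq> {..<N} \<and> v \<subseteq> {..<N} \<and> card (sym_diff u v) = 2 * q * r" if "(u, v) \<in> F" for u v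
    using F(1) that by (auto simp: E_def)
  have d0: "0 < 2 * q * r" and Nn: "N \<le> n"
    using q0 r0 n by (simp_all add: N_def)
  from distance_graph_of_set_system[OF Nn d0 F(2,3) F'] obtain G
    where G: "G \<in> high_girth_distance_graphs n k"
      "\<And>c. colourable G c \<Longrightarrow> \<exists>f. (\<forall>u \<subseteq> {..<N}. f u < c) \<and> (\<forall>(u, v) \<in> F. f u \<noteq> f v)"
    by blast
  have "3 ^ q \<le> 2 * c * 2 ^ q" if "colourable G c" for c
  proof -
    obtain f where f: "\<And>u. u \<subseteq> {..<N} \<Longrightarrow> f u < c" "\<And>u v. (u, v) \<in> F \<Longrightarrow> f u \<noteq> f v"
      using G(2)[OF \<open>colourable G c\<close>] by blast
    define cls where "cls j = {u. u \<subseteq> {..<N} \<and> f u = j}" for j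
    have "cls j \<notin> \<S>" for j
    proof
      assume "cls j \<in> \<S>"
      then obtain u v where "(u, v) \<in> F" "u \<in> cls j" "v \<in> cls j"
        using hit by fast
      then show False
        using f(2)[of u v] by (simp add: cls_def)
    qed
    moreover have "cls j \<subseteq> Pow {..<N}" for j
      by (auto simp: cls_def)
    ultimately have small: "card (cls j) * 3 ^ q \<le> 2 * 2 ^ N * 2 ^ q" for j
      by (simp add: \<S>_def not_le less_imp_le)
    have "Pow {..<N} = (\<Union>j<c. cls j)"
      using f(1) by (auto simp: cls_def)
    then have "2 ^ N = card (\<Union>j<c. cls j)"
      by (metis card_Pow card_lessThan finite_lessThan)
    also have "\<dots> \<le> (\<Sum>j<c. card (cls j))"
      by (intro card_UN_le) simp
    finally have "2 ^ N * 3 ^ q \<le> (\<Sum>j<c. card (cls j)) * 3 ^ q"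
      by (rule mult_le_mono1)
    also have "\<dots> \<le> c * (2 * 2 ^ N * 2 ^ q)"
      using sum_bounded_above[of "{..<c}" "\<lambda>j. card (cls j) * 3 ^ q" "2 * 2 ^ N * 2 ^ q"] small
      by (simp add: sum_distrib_right)
    finally have "2 ^ N * 3 ^ q \<le> 2 ^ N * (2 * c * 2 ^ q)"
      by (simp add: mult_ac)
    then show ?thesis
      by simp
  qed
  with G(1) show thesis
    by (rule that)
qed

section \<open>Passage to the limit inferior over all dimensions\<close>

text \<open>A finite value rules out the empty set of colour numbers, and a nonempty set in
  \<open>enat\<close> attains its infimum.\<close>

lemma chromatic_number_eq_enat:
  assumes "chromatic_number G = enat c"
  shows "colourable G c"
proof -
  have "chromatic_number G \<in> {enat c | c. colourable G c}"
    using assms LeastI_ex[of "\<lambda>x. x \<in> {enat c | c. colourable G c}"]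
    unfolding chromatic_number_def Inf_enat_def by (auto split: if_splits)
  then show ?thesis
    using assms by auto
qed

theorem theorem1:
  shows "\<forall>k :: nat. k \<ge> 3 \<longrightarrow> (\<exists>\<delta> :: real. \<delta> > 0 \<and> xi k \<ge> ereal (1 + \<delta>))"
proof (intro allI impI)
  fix k :: nat
  define r where "r = 14 * k + 7"
  \<comment> \<open>The graphs below need at least \<open>(3 / 2) powr (q / 2)\<close> colours in
    dimension \<open>n \<le> 10 * q * r\<close>, and \<open>(q / 2) / n\<close> is then at least
    \<open>1 / (20 * r)\<close>.\<close>
  define b where "b = (3 / 2 :: real) powr (1 / (20 * real r))"
  have r0: "0 < r"
    by (simp add: r_def)
  have "ereal b \<le> (SUP G \<in> high_girth_distance_graphs n k. enat_root n (chromatic_number G))"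
    if n: "20 * r \<le> n" for n
  proof -
    have "4 \<le> n div (5 * r)"
      using n r0 by (simp add: less_eq_div_iff_mult_less_eq)
    \<comment> \<open>\<open>2 ^ a\<close> is the largest power of two with
      \<open>5 * 2 ^ a * r \<le> n\<close>, so passing from \<open>n\<close> to this smaller
      dimension loses less than a factor 2.\<close>
    then obtain a where a: "2 ^ a \<le> n div (5 * r)" "n div (5 * r) < 2 ^ (a + 1)"
      using ex_power_ivl1[of 2 "n div (5 * r)"] by auto
    define q where "q = (2 :: nat) ^ a"
    have "(2 :: nat) ^ 2 < 2 ^ (a + 1)"
      using a(2) \<open>4 \<le> n div (5 * r)\<close> by simp
    then have "2 < a + 1"
      by (rule power_less_imp_less_exp[rotated]) simp
    then have a2: "2 \<le> a"
      by simp
    have q4: "4 \<le> q"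
      using power_increasing[OF a2, of "2 :: nat"] by (simp add: q_def)
    have "q * (5 * r) \<le> n"
      using a(1) r0 by (simp add: less_eq_div_iff_mult_less_eq q_def)
    then have qn: "5 * q * r \<le> n"
      by (simp add: mult_ac)
    have "n < 2 * q * (5 * r)"
      using a(2) r0 by (simp add: div_less_iff_less_mult q_def)
    then have "n \<le> 10 * q * r"
      by simp
    then have nq: "real n \<le> 10 * real q * real r"
      using of_nat_mono[of n "10 * q * r", where 'a = real] by simp
    obtain G where G: "G \<in> high_girth_distance_graphs n k"
      "\<And>c. colourable G c \<Longrightarrow> 3 ^ q \<le> 2 * c * 2 ^ q"
      using exists_high_girth_distance_graph[OF q_def, of k n] a2 qn by (auto simp: r_def)
    have n0: "0 < n"
      using n r0 by simp
    have "ereal b \<le> enat_root n (chromatic_number G)"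
    proof (cases "chromatic_number G")
      case (enat c)
      then have "3 ^ q \<le> 2 * c * 2 ^ q"
        using G(2) chromatic_number_eq_enat by blast
      then have "real (3 ^ q) \<le> real (2 * c * 2 ^ q)"
        by (simp only: of_nat_le_iff)
      then have "(3 / 2) ^ q \<le> 2 * real c"
        by (simp add: power_divide field_simps)
      \<comment> \<open>Half of the exponent absorbs the factor 2, since \<open>q \<ge> 4\<close>
        gives \<open>(3 / 2) powr (q / 2) \<ge> 9 / 4\<close>.\<close>
      moreover have "2 * (3 / 2) powr (real q / 2) \<le> (3 / 2 :: real) ^ q"
      proof -
        have "2 \<le> (3 / 2 :: real) powr 2"
          by (simp add: power2_eq_square)
        also have "\<dots> \<le> (3 / 2) powr (real q / 2)"
          using q4 by (intro powr_mono) auto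
        finally have "2 * (3 / 2) powr (real q / 2) \<le> (3 / 2 :: real) powr (real q / 2) * (3 / 2) powr (real q / 2)"
          by (rule mult_right_mono) simp
        then show ?thesis
          by (simp add: powr_realpow flip: powr_add)
      qed
      ultimately have c: "(3 / 2) powr (real q / 2) \<le> real c"
        by linarith
      have "b \<le> (3 / 2) powr (real q / 2 * (1 / real n))"
        unfolding b_def using nq n0 r0 by (intro powr_mono) (auto simp: field_simps)
      also have "\<dots> = ((3 / 2) powr (real q / 2)) powr (1 / real n)"
        by (simp add: powr_powr)
      also have "\<dots> \<le> real c powr (1 / real n)"
        using c by (intro powr_mono2) auto
      finally show ?thesis
        by (simp add: enat)
    qed simp
    then show ?thesis
      using G(1) by (rule SUP_upper2[rotated])
  qed
  then have "\<forall>\<^sub>F n in sequentially. ereal b \<le> (SUP G \<in> high_girth_distance_graphs n k. enat_root n (chromatic_number G))"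
    by (auto simp: eventually_sequentially)
  then have "ereal b \<le> xi k"
    unfolding xi_def by (rule Liminf_bounded)
  moreover have "1 < b"
    using r0 by (simp add: b_def)
  ultimately show "\<exists>\<delta> > 0. ereal (1 + \<delta>) \<le> xi k"
    by (intro exI[of _ "b - 1"]) simp
qed

end
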